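(* For a $P$-space $X$ the following properties are equivalent: (1) $X$ is almost Lindelöf; (2) $X$ is almost Menger; (3) $X$ is almost Scheepers; (4) $X$ is almost Alster; (5) $X$ is weakly Lindelöf; (6) $X$ is weakly Menger; (7) $X$ is weakly Scheepers; (8) $X$ is weakly Alster.
   Context: A $P$-space is a topological space in which every $G_\delta$ set is open. $X$ is almost Lindelöf (respectively, weakly Lindelöf) if every open cover $\mathcal{U}$ of $X$ has a countable subset $\mathcal{V}$ such that $\{\overline{V}:V\in\mathcal{V}\}$ covers $X$ (respectively, $\bigcup\mathcal{V}$ is dense in $X$). $X$ is almost Menger (respectively, weakly Menger) if for every sequence $(\mathcal{U}_n)_{n\in\mathbb{N}}$ of open covers of $X$ there are finite $\mathcal{V}_n\subseteq\mathcal{U}_n$ such that $\{\overline{V}:V\in\bigcup_n\mathcal{V}_n\}$ covers $X$ (respectively, $\bigcup\left(\bigcup_n\mathcal{V}_n\right)$ is dense in $X$). $X$ is almost Scheepers if for every sequence $(\mathcal{U}_n)$ of open covers of $X$ there are finite $\mathcal{V}_n\subseteq\mathcal{U}_n$ such that every finite $F\subseteq X$ is contained in $\overline{\bigcup\mathcal{V}_n}$ for some $n$. $X$ is weakly Scheepers if for every sequence $(\mathcal{U}_n)$ of open covers of $X$ there are finite $\mathcal{V}_n\subseteq\mathcal{U}_n$ such that for every finite collection $\mathcal{F}$ of nonempty open subsets of $X$ there is an $n$ with $U\cap\left(\bigcup\mathcal{V}_n\right)\neq\emptyset$ for all $U\in\mathcal{F}$. Let $\mathcal{G}_K$ be the class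 of all families $\mathcal{U}$ of $G_\delta$ subsets of $X$ such that $X\notin\mathcal{U}$ and every compact $C\subseteq X$ is contained in some $U\in\mathcal{U}$. $X$ is almost Alster (respectively, weakly Alster) if each $\mathcal{U}\in\mathcal{G}_K$ has a countable subset $\mathcal{V}$ such that $\{\overline{V}:V\in\mathcal{V}\}$ covers $X$ (respectively, $\bigcup\mathcal{V}$ is dense in $X$). *)

theory Defs
  imports "HOL-Analysis.Analysis"
begin

definition P_space :: "'a topology \<Rightarrow> bool" where
  "P_space X \<longleftrightarrow> (\<forall>S. gdelta_in X S \<longrightarrow> openin X S)"

definition open_cover :: "'a topology \<Rightarrow> 'a set set \<Rightarrow> bool" where
  "open_cover X \<U> \<longleftrightarrow> (\<forall>U\<in>\<U>. openin X U) \<and> \<Union>\<U> = topspace X"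

definition closures_cover :: "'a topology \<Rightarrow> 'a set set \<Rightarrow> bool" where
  "closures_cover X \<V> \<longleftrightarrow> (\<Union>V\<in>\<V>. X closure_of V) = topspace X"

definition dense_union :: "'a topology \<Rightarrow> 'a set set \<Rightarrow> bool" where
  "dense_union X \<V> \<longleftrightarrow> X closure_of (\<Union>\<V>) = topspace X"

definition almost_Lindelof :: "'a topology \<Rightarrow> bool" where
  "almost_Lindelof X \<longleftrightarrow>
    (\<forall>\<U>. open_cover X \<U> \<longrightarrow> (\<exists>\<V>. \<V> \<subseteq> \<U> \<and> countable \<V> \<and> closures_cover X \<V>))"

definition weakly_Lindelof :: "'a topology \<Rightarrow> bool" where
  "weakly_Lindelof X \<longleftrightarrow>
    (\<forall>\<U>. open_cover X \<U> \<longrightarrow> (\<exists>\<V>. \<V> \<subseteq> \<U> \<and> countable \<V> \<and> dense_union X \<V>))"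

definition almost_Menger :: "'a topology \<Rightarrow> bool" where
  "almost_Menger X \<longleftrightarrow>
    (\<forall>\<U>::nat \<Rightarrow> 'a set set. (\<forall>n. open_cover X (\<U> n)) \<longrightarrow>
      (\<exists>\<V>::nat \<Rightarrow> 'a set set. (\<forall>n. finite (\<V> n) \<and> \<V> n \<subseteq> \<U> n) \<and> closures_cover X (\<Union>n. \<V> n)))"

definition weakly_Menger :: "'a topology \<Rightarrow> bool" where
  "weakly_Menger X \<longleftrightarrow>
    (\<forall>\<U>::nat \<Rightarrow> 'a set set. (\<forall>n. open_cover X (\<U> n)) \<longrightarrow>
      (\<exists>\<V>::nat \<Rightarrow> 'a set set. (\<forall>n. finite (\<V> n) \<and> \<V> n \<subseteq> \<U> n) \<and> dense_union X (\<Union>n. \<V> n)))"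

definition almost_Scheepers :: "'a topology \<Rightarrow> bool" where
  "almost_Scheepers X \<longleftrightarrow>
    (\<forall>\<U>::nat \<Rightarrow> 'a set set. (\<forall>n. open_cover X (\<U> n)) \<longrightarrow>
      (\<exists>\<V>::nat \<Rightarrow> 'a set set. (\<forall>n. finite (\<V> n) \<and> \<V> n \<subseteq> \<U> n) \<and>
        (\<forall>F. finite F \<and> F \<subseteq> topspace X \<longrightarrow> (\<exists>n. F \<subseteq> X closure_of \<Union>(\<V> n)))))"

definition weakly_Scheepers :: "'a topology \<Rightarrow> bool" where
  "weakly_Scheepers X \<longleftrightarrow>
    (\<forall>\<U>::nat \<Rightarrow> 'a set set. (\<forall>n. open_cover X (\<U> n)) \<longrightarrow>
      (\<exists>\<V>::nat \<Rightarrow> 'a set set. (\<forall>n. finite (\<V> n) \<and> \<V> n \<subseteq> \<U> n) \<and>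
        (\<forall>\<F>. finite \<F> \<and> (\<forall>U\<in>\<F>. openin X U \<and> U \<noteq> {}) \<longrightarrow>
          (\<exists>n. \<forall>U\<in>\<F>. U \<inter> \<Union>(\<V> n) \<noteq> {}))))"

definition GK :: "'a topology \<Rightarrow> 'a set set set" where
  "GK X = {\<U>. (\<forall>U\<in>\<U>. gdelta_in X U) \<and> topspace X \<notin> \<U> \<and>
               (\<forall>C. compactin X C \<longrightarrow> (\<exists>U\<in>\<U>. C \<subseteq> U))}"

definition almost_Alster :: "'a topology \<Rightarrow> bool" where
  "almost_Alster X \<longleftrightarrow>
    (\<forall>\<U>\<in>GK X. \<exists>\<V>. \<V> \<subseteq> \<U> \<and> countable \<V> \<and> closures_cover X \<V>)"

definition weakly_Alster :: "'a topology \<Rightarrow> bool" where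
  "weakly_Alster X \<longleftrightarrow>
    (\<forall>\<U>\<in>GK X. \<exists>\<V>. \<V> \<subseteq> \<U> \<and> countable \<V> \<and> dense_union X \<V>)"

end

theory Submission
  imports Defs
begin

text \<open>
  In a P-space a countable union of closed sets is closed, so the closure of a countable union is
  the union of the closures; hence each weak covering property that asks for a countable family
  coincides with its almost version. Moreover, for open covers \<open>\<U>\<^sub>n\<close> the sets
  \<open>\<Inter>\<^sub>n U\<^sub>n\<close> with \<open>U\<^sub>n \<in> \<U>\<^sub>n\<close> form an open cover refining all of them. If countably many
  such sets \<open>W\<^sub>k = \<Inter>\<^sub>n U\<^sub>k\<^sub>,\<^sub>n\<close> have closures covering \<open>X\<close>, then
  \<open>\<V>\<^sub>n = {U\<^sub>k\<^sub>,\<^sub>n | k \<le> n}\<close> witnesses the almost Scheepers property. For the Alster properties,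
  \<open>G\<^sub>\<delta>\<close> sets are open and singletons are compact, while conversely the finite unions of
  members of an open cover contain all compact sets.
\<close>

lemma P_space_openin_INT:
  fixes f :: "nat \<Rightarrow> 'a set"
  assumes "P_space X" "\<And>n. openin X (f n)"
  shows "openin X (\<Inter>n. f n)"
proof -
  have "gdelta_in X (\<Inter>(range f))"
    by (rule gdelta_in_Inter) (auto intro: open_imp_gdelta_in assms)
  then show ?thesis
    using assms(1) by (simp add: P_space_def)
qed

lemma P_space_closure_of_Union:
  assumes "P_space X" "countable \<V>"
  shows "X closure_of \<Union>\<V> = (\<Union>V\<in>\<V>. X closure_of V)"
proof
  have "fsigma_in X (\<Union>((\<lambda>V. X closure_of V) ` \<V>))"
    by (rule fsigma_in_Union) (auto intro: closed_imp_fsigma_in assms)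
  \<comment> \<open>The complement of an F-sigma set is a G-delta set, hence open in a
    P-space.\<close>
  then have closed: "closedin X (\<Union>V\<in>\<V>. X closure_of V)"
    using assms(1) by (auto simp: P_space_def fsigma_in_gdelta_in closedin_def)
  \<comment> \<open>Members of \<open>\<V>\<close> may contain points outside the space, and such
    points lie in no closure. Cutting down to \<open>topspace X\<close> first makes the minimality
    of the closure applicable.\<close>
  have "X closure_of \<Union>\<V> = X closure_of (topspace X \<inter> \<Union>\<V>)"
    by (rule closure_of_restrict)
  also have "\<dots> \<subseteq> (\<Union>V\<in>\<V>. X closure_of V)"
  proof (rule closure_of_minimal[OF _ closed])
    show "topspace X \<inter> \<Union>\<V> \<subseteq> (\<Union>V\<in>\<V>. X closure_of V)"
      using closure_of_subset_Int[of X] by fastforce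
  qed
  finally show "X closure_of \<Union>\<V> \<subseteq> (\<Union>V\<in>\<V>. X closure_of V)" .
  show "(\<Union>V\<in>\<V>. X closure_of V) \<subseteq> X closure_of \<Union>\<V>"
    by (intro UN_least closure_of_mono Union_upper)
qed

lemma P_space_closures_cover_iff_dense_union:
  assumes "P_space X" "countable \<V>"
  shows "closures_cover X \<V> \<longleftrightarrow> dense_union X \<V>"
  using P_space_closure_of_Union[OF assms]
  by (simp add: closures_cover_def dense_union_def)

lemma P_space_almost_Lindelof_iff_weakly:
  assumes "P_space X"
  shows "almost_Lindelof X \<longleftrightarrow> weakly_Lindelof X"
  \<comment> \<open>\<open>conj_cong\<close> supplies \<open>countable \<V>\<close> as the premise
    of the conditional rewrite of the covering condition.\<close>
  by (simp add: almost_Lindelof_def weakly_Lindelof_def P_space_closures_cover_iff_dense_union[OF assms]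
      cong: conj_cong)

lemma P_space_almost_Alster_iff_weakly:
  assumes "P_space X"
  shows "almost_Alster X \<longleftrightarrow> weakly_Alster X"
  by (simp add: almost_Alster_def weakly_Alster_def P_space_closures_cover_iff_dense_union[OF assms]
      cong: conj_cong)

lemma P_space_almost_Menger_iff_weakly:
  assumes "P_space X"
  shows "almost_Menger X \<longleftrightarrow> weakly_Menger X"
  by (simp add: almost_Menger_def weakly_Menger_def countable_finite
      P_space_closures_cover_iff_dense_union[OF assms] cong: conj_cong)

lemma P_space_almost_Lindelof_imp_almost_Scheepers:
  assumes X: "P_space X" and L: "almost_Lindelof X"
  shows "almost_Scheepers X"
  unfolding almost_Scheepers_def
proof (intro allI impI)
  fix \<U> :: "nat \<Rightarrow> 'a set set"
  assume \<U>: "\<forall>n. open_cover X (\<U> n)"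
  define \<W> where "\<W> = (\<lambda>f. \<Inter>n. f n) ` {f. \<forall>n. f n \<in> \<U> n}"
  have "open_cover X \<W>"
    unfolding open_cover_def
  proof (intro conjI ballI)
    show opn: "openin X W" if W: "W \<in> \<W>" for W
    proof -
      obtain f where "\<forall>n. f n \<in> \<U> n" "W = (\<Inter>n. f n)"
        using W unfolding \<W>_def by blast
      then show ?thesis
        using \<U> P_space_openin_INT[OF X, of f] by (auto simp: open_cover_def)
    qed
    have "x \<in> \<Union>\<W>" if "x \<in> topspace X" for x
    proof -
      have "\<forall>n. \<exists>U\<in>\<U> n. x \<in> U"
        using \<U> that unfolding open_cover_def by blast
      then obtain f where "\<forall>n. f n \<in> \<U> n \<and> x \<in> f n"
        by metis
      then show ?thesis
        by (auto simp: \<W>_def)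
    qed
    then show "\<Union>\<W> = topspace X"
      using opn openin_subset by blast
  qed
  then obtain \<C> where \<C>: "\<C> \<subseteq> \<W>" "countable \<C>" "closures_cover X \<C>"
    using L unfolding almost_Lindelof_def by blast
  show "\<exists>\<V>. (\<forall>n. finite (\<V> n) \<and> \<V> n \<subseteq> \<U> n) \<and>
          (\<forall>F. finite F \<and> F \<subseteq> topspace X \<longrightarrow> (\<exists>n. F \<subseteq> X closure_of \<Union>(\<V> n)))"
  \<comment> \<open>Enumerating \<open>\<C>\<close> by \<open>from_nat_into\<close> requires a
    nonempty family; an empty \<open>\<C>\<close> forces an empty space.\<close>
  proof (cases "\<C> = {}")
    case True
    then have "topspace X = {}"
      using \<C>(3) by (simp add: closures_cover_def)
    then show ?thesis
      by (intro exI[of _ "\<lambda>_. {}"]) auto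
  next
    case False
    define W where "W = from_nat_into \<C>"
    have W: "range W = \<C>"
      unfolding W_def using False \<C>(2) by (rule range_from_nat_into)
    have "\<forall>k. \<exists>f. (\<forall>n. f n \<in> \<U> n) \<and> W k = (\<Inter>n. f n)"
      using W \<C>(1) unfolding \<W>_def by blast
    then obtain f where f: "\<And>k n. f k n \<in> \<U> n" "\<And>k. W k = (\<Inter>n. f k n)"
      by metis
    \<comment> \<open>Each \<open>x\<close> in \<open>F\<close> lies in the closure of some
      \<open>W (g x)\<close>. If \<open>n\<close> bounds all \<open>g x\<close>, then
      \<open>W (g x) \<subseteq> f (g x) n\<close>, and this set is among the first
      \<open>n + 1\<close> choices from \<open>\<U> n\<close>. So a single \<open>n\<close> serves
      all of \<open>F\<close>.\<close>
    have "\<exists>n. F \<subseteq> X closure_of \<Union>((\<lambda>k. f k n) ` {..n})"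
      if F: "finite F" "F \<subseteq> topspace X" for F
    proof -
      have "\<forall>x\<in>F. \<exists>k. x \<in> X closure_of W k"
        using F(2) \<C>(3) W unfolding closures_cover_def by blast
      then obtain g where g: "\<And>x. x \<in> F \<Longrightarrow> x \<in> X closure_of W (g x)"
        by metis
      obtain n where n: "\<And>x. x \<in> F \<Longrightarrow> g x \<le> n"
        using finite_nat_set_iff_bounded_le[of "g ` F"] F(1) by auto
      have "W (g x) \<subseteq> \<Union>((\<lambda>k. f k n) ` {..n})" if "x \<in> F" for x
        using n[OF that] f(2) by blast
      then show ?thesis
        using g closure_of_mono by blast
    qed
    then show ?thesis
      using f(1) by (intro exI[of _ "\<lambda>n. (\<lambda>k. f k n) ` {..n}"]) auto
  qed
qed

text \<open>One point chosen from each of the given open sets forms a finite set, to which the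
  almost version applies. An open set that meets the closure of a set meets the set itself.\<close>

lemma almost_Scheepers_imp_weakly_Scheepers:
  assumes "almost_Scheepers X"
  shows "weakly_Scheepers X"
  unfolding weakly_Scheepers_def
proof (intro allI impI)
  fix \<U> :: "nat \<Rightarrow> 'a set set"
  assume "\<forall>n. open_cover X (\<U> n)"
  then obtain \<V> where \<V>: "\<forall>n. finite (\<V> n) \<and> \<V> n \<subseteq> \<U> n"
    and S: "\<forall>F. finite F \<and> F \<subseteq> topspace X \<longrightarrow> (\<exists>n. F \<subseteq> X closure_of \<Union>(\<V> n))"
    using assms[unfolded almost_Scheepers_def, THEN spec[of _ \<U>]] by (elim impE exE conjE)
  have "\<exists>n. \<forall>U\<in>\<F>. U \<inter> \<Union>(\<V> n) \<noteq> {}"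
    if \<F>: "finite \<F>" "\<forall>U\<in>\<F>. openin X U \<and> U \<noteq> {}" for \<F>
  proof -
    have "\<forall>U\<in>\<F>. \<exists>x. x \<in> U"
      using \<F>(2) by blast
    then obtain p where p: "\<And>U. U \<in> \<F> \<Longrightarrow> p U \<in> U"
      by metis
    have "p ` \<F> \<subseteq> topspace X"
      using p \<F>(2) by (meson image_subsetI openin_subset subsetD)
    then obtain n where "p ` \<F> \<subseteq> X closure_of \<Union>(\<V> n)"
      using S \<F>(1) by (metis finite_imageI)
    then have "p U \<in> U \<inter> X closure_of \<Union>(\<V> n)" if "U \<in> \<F>" for U
      using p that by auto
    then have "U \<inter> X closure_of \<Union>(\<V> n) \<noteq> {}" if "U \<in> \<F>" for U
      using that by (metis empty_iff)
    then have "U \<inter> \<Union>(\<V> n) \<noteq> {}" if "U \<in> \<F>" for U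
      using \<F>(2) that by (simp add: openin_Int_closure_of_eq_empty)
    then show ?thesis
      by blast
  qed
  with \<V> show "\<exists>\<V>. (\<forall>n. finite (\<V> n) \<and> \<V> n \<subseteq> \<U> n) \<and>
          (\<forall>\<F>. finite \<F> \<and> (\<forall>U\<in>\<F>. openin X U \<and> U \<noteq> {}) \<longrightarrow>
            (\<exists>n. \<forall>U\<in>\<F>. U \<inter> \<Union>(\<V> n) \<noteq> {}))"
    by (intro exI[of _ \<V>]) simp
qed

text \<open>Testing with the one-element families \<open>{U}\<close> shows that the union of all
  selected sets meets every nonempty open \<open>U\<close>, which is density.\<close>

lemma weakly_Scheepers_imp_weakly_Menger:
  assumes "weakly_Scheepers X"
  shows "weakly_Menger X"
  unfolding weakly_Menger_def
proof (intro allI impI)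
  fix \<U> :: "nat \<Rightarrow> 'a set set"
  assume "\<forall>n. open_cover X (\<U> n)"
  then obtain \<V> where \<V>: "\<forall>n. finite (\<V> n) \<and> \<V> n \<subseteq> \<U> n"
    and S: "\<And>\<F>. finite \<F> \<Longrightarrow> (\<forall>U\<in>\<F>. openin X U \<and> U \<noteq> {}) \<Longrightarrow>
            \<exists>n. \<forall>U\<in>\<F>. U \<inter> \<Union>(\<V> n) \<noteq> {}"
    using assms unfolding weakly_Scheepers_def by metis
  have "U \<inter> \<Union>(\<Union>n. \<V> n) \<noteq> {}" if "openin X U" "U \<noteq> {}" for U
    using S[of "{U}"] that by auto
  then have "dense_union X (\<Union>n. \<V> n)"
    unfolding dense_union_def dense_intersects_open by (metis Int_commute)
  with \<V> show "\<exists>\<V>. (\<forall>n. finite (\<V> n) \<and> \<V> n \<subseteq> \<U> n) \<and> dense_union X (\<Union>n. \<V> n)"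
    by blast
qed

text \<open>Apply the Menger property to a constant sequence of covers and merge the finite
  selections.\<close>

lemma weakly_Menger_imp_weakly_Lindelof:
  assumes "weakly_Menger X"
  shows "weakly_Lindelof X"
  unfolding weakly_Lindelof_def
proof (intro allI impI)
  fix \<U>
  assume "open_cover X \<U>"
  then obtain \<V> :: "nat \<Rightarrow> 'a set set"
    where "\<forall>n. finite (\<V> n) \<and> \<V> n \<subseteq> \<U>" "dense_union X (\<Union>n. \<V> n)"
    using assms[unfolded weakly_Menger_def, rule_format, of "\<lambda>_. \<U>"] by blast
  then show "\<exists>\<V>. \<V> \<subseteq> \<U> \<and> countable \<V> \<and> dense_union X \<V>"
    by (intro exI[of _ "\<Union>n. \<V> n"]) (auto intro: countable_finite)
qed

lemma P_space_weakly_Lindelof_imp_weakly_Alster: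
  assumes X: "P_space X" and L: "weakly_Lindelof X"
  shows "weakly_Alster X"
  unfolding weakly_Alster_def
proof
  fix \<U>
  assume \<U>: "\<U> \<in> GK X"
  then have opn: "openin X U" if "U \<in> \<U>" for U
    using X that by (auto simp: GK_def P_space_def)
  have "x \<in> \<Union>\<U>" if "x \<in> topspace X" for x
  proof -
    have "compactin X {x}"
      using that by simp
    then show ?thesis
      using \<U> unfolding GK_def by blast
  qed
  then have "open_cover X \<U>"
    using opn openin_subset unfolding open_cover_def by blast
  then show "\<exists>\<V>\<subseteq>\<U>. countable \<V> \<and> dense_union X \<V>"
    using L unfolding weakly_Lindelof_def by blast
qed

lemma weakly_Alster_imp_weakly_Lindelof:
  assumes "weakly_Alster X"
  shows "weakly_Lindelof X"
  unfolding weakly_Lindelof_def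
proof (intro allI impI)
  fix \<U>
  assume \<U>: "open_cover X \<U>"
  define \<F> where "\<F> = {W. \<exists>\<A>. finite \<A> \<and> \<A> \<subseteq> \<U> \<and> W = \<Union>\<A>}"
  show "\<exists>\<V>. \<V> \<subseteq> \<U> \<and> countable \<V> \<and> dense_union X \<V>"
  \<comment> \<open>Families in \<open>GK X\<close> must omit the whole space. If some finite union
    already equals it, that finite subfamily is the required one.\<close>
  proof (cases "topspace X \<in> \<F>")
    case True
    then obtain \<A> where "finite \<A>" "\<A> \<subseteq> \<U>" "topspace X = \<Union>\<A>"
      unfolding \<F>_def by auto
    then show ?thesis
      by (metis closure_of_topspace countable_finite dense_union_def)
  next
    case False
    have "gdelta_in X U" if "U \<in> \<F>" for U
      using that \<U> unfolding \<F>_def open_cover_def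
      by (auto intro!: open_imp_gdelta_in openin_Union)
    moreover have "\<exists>U\<in>\<F>. C \<subseteq> U" if C: "compactin X C" for C
    proof -
      have "C \<subseteq> \<Union>\<U>"
        using compactin_subset_topspace[OF C] \<U> by (simp add: open_cover_def)
      then have "\<exists>\<A>. finite \<A> \<and> \<A> \<subseteq> \<U> \<and> C \<subseteq> \<Union>\<A>"
        using \<U> by (intro compactinD[OF C]) (auto simp: open_cover_def)
      then show ?thesis
        unfolding \<F>_def by auto
    qed
    ultimately have "\<F> \<in> GK X"
      using False by (simp add: GK_def)
    then obtain \<W> where \<W>: "\<W> \<subseteq> \<F>" "countable \<W>" "dense_union X \<W>"
      using assms unfolding weakly_Alster_def by blast
    \<comment> \<open>Each selected finite union is split back into members of \<open>\<U>\<close>;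
      this leaves the total union unchanged and the family countable.\<close>
    have "\<forall>W\<in>\<W>. \<exists>\<A>. finite \<A> \<and> \<A> \<subseteq> \<U> \<and> \<Union>\<A> = W"
      using \<W>(1) by (auto simp: \<F>_def)
    then obtain \<A> where \<A>: "\<And>W. W \<in> \<W> \<Longrightarrow> finite (\<A> W) \<and> \<A> W \<subseteq> \<U> \<and> \<Union>(\<A> W) = W"
      by metis
    have "\<Union>(\<Union>W\<in>\<W>. \<A> W) = (\<Union>W\<in>\<W>. \<Union>(\<A> W))"
      by blast
    also have "\<dots> = \<Union>\<W>"
      using \<A> by auto
    finally have "\<Union>(\<Union>W\<in>\<W>. \<A> W) = \<Union>\<W>" .
    then have "dense_union X (\<Union>W\<in>\<W>. \<A> W)"
      using \<W>(3) by (simp add: dense_union_def)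
    moreover have "countable (\<Union>W\<in>\<W>. \<A> W)"
      using \<W>(2) \<A> by (simp add: countable_finite)
    moreover have "(\<Union>W\<in>\<W>. \<A> W) \<subseteq> \<U>"
      using \<A> by blast
    ultimately show ?thesis
      by blast
  qed
qed

theorem theorem3p8:
  fixes X :: "'a topology"
  assumes "P_space X"
  shows "(almost_Lindelof X \<longleftrightarrow> almost_Menger X) \<and>
         (almost_Menger X \<longleftrightarrow> almost_Scheepers X) \<and>
         (almost_Scheepers X \<longleftrightarrow> almost_Alster X) \<and>
         (almost_Alster X \<longleftrightarrow> weakly_Lindelof X) \<and>
         (weakly_Lindelof X \<longleftrightarrow> weakly_Menger X) \<and>
         (weakly_Menger X \<longleftrightarrow> weakly_Scheepers X) \<and>
         (weakly_Scheepers X \<longleftrightarrow> weakly_Alster X)"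
  \<comment> \<open>The cycle runs almost Lindelof, almost Scheepers, weakly Scheepers, weakly
    Menger, weakly Lindelof and back. Weakly Alster is tied to weakly Lindelof in both directions,
    and almost Menger and almost Alster join through their weak versions.\<close>
  using P_space_almost_Lindelof_iff_weakly[OF assms] P_space_almost_Menger_iff_weakly[OF assms]
    P_space_almost_Alster_iff_weakly[OF assms]
    P_space_almost_Lindelof_imp_almost_Scheepers[OF assms]
    almost_Scheepers_imp_weakly_Scheepers[of X] weakly_Scheepers_imp_weakly_Menger[of X]
    weakly_Menger_imp_weakly_Lindelof[of X] P_space_weakly_Lindelof_imp_weakly_Alster[OF assms]
    weakly_Alster_imp_weakly_Lindelof[of X]
  by blast

end
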